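(* Let $X$ be a continuum and let $f,g\colon X\to X$ be kin, i.e. there is a homeomorphism $h\colon X\to X$, an onto map $\varphi\colon X\to X$ which commutes with $h$, integers $a,b\ge 0$ and $n,m\in\mathbb{N}$ such that $f=h^a\circ\varphi^n$ and $g=h^b\circ\varphi^m$. Let $G\colon\varprojlim(X,f)\to\varprojlim(X,f)$ be the diagonal map defined by $$G((x_0,x_1,x_2,\ldots)):=(g(x_1),g(x_2),\ldots).$$ Then $\mathrm{Ent}(G)=\mathrm{Ent}(h^{b-a}\circ\varphi^{m-n})$.
   Context: A continuum is a compact, connected metric space (metric $d_X$). A map is a continuous function; $\mathbb{N}=\{1,2,\ldots\}$; powers denote iterates. For an onto map $\varphi$ and $k\in\mathbb{N}$, $\varphi^{-k}$ denotes the set-valued function $x\mapsto(\varphi^k)^{-1}(x)=\{y:\varphi^k(y)=x\}$; compositions of (set-valued) functions are defined by $(F\circ G)(x)=\bigcup_{y\in G(x)}F(y)$. Thus $h^{b-a}\circ\varphi^{m-n}$ is an ordinary map if $m\ge n$ and in general a set-valued function if $m<n$. Inverse limit: $\varprojlim(X,f)=\{(x_0,x_1,x_2,\ldots)\in\prod_{i\ge0}X: f(x_i)=x_{i-1}\text{ for all }i\in\mathbb{N}\}$ with the product topology; it is a continuum. Entropy: let $2^X$ be the set of non-empty closed subsets of $X$, and let $F\colon X\to 2^X$ be upper semi-continuous, meaning that $\{(x,y):y\in F(x)\}$ is closed in $X\times X$. An $n$-orbit of $F$ is $(x_1,\ldots,x_n)\in X^n$ with $x_{i+1}\in F(x_i)$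 for $1\le i<n$. A set $S$ of $n$-orbits is $(n,\varepsilon)$-separated if for every two distinct $(x_1,\ldots,x_n),(y_1,\ldots,y_n)\in S$ there is $i$ with $d_X(x_i,y_i)\ge\varepsilon$. Let $s_{n,\varepsilon}(F)$ be the largest cardinality of an $(n,\varepsilon)$-separated set. Then $\mathrm{Ent}(F)=\lim_{\varepsilon\to0}\limsup_{n\to\infty}\frac1n\log s_{n,\varepsilon}(F)\in[0,+\infty]$. A map $f$ is regarded as the set-valued function $x\mapsto\{f(x)\}$, and $\mathrm{Ent}(f)$ is then its topological entropy. *)

theory Defs
  imports "HOL-Analysis.Analysis"
begin

definition continuum :: "'a::metric_space set \<Rightarrow> bool" where
  "continuum X \<longleftrightarrow> compact X \<and> connected X"

definition inverse_limit :: "'a set \<Rightarrow> ('a \<Rightarrow> 'a) \<Rightarrow> (nat \<Rightarrow> 'a) set" where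
  "inverse_limit X f = {x. (\<forall>i. x i \<in> X) \<and> (\<forall>i. f (x (Suc i)) = x i)}"

definition inverse_limit_topology ::
    "'a::topological_space set \<Rightarrow> ('a \<Rightarrow> 'a) \<Rightarrow> (nat \<Rightarrow> 'a) topology" where
  "inverse_limit_topology X f =
     subtopology (product_topology (\<lambda>_. top_of_set X) UNIV) (inverse_limit X f)"

definition diagonal_map :: "('a \<Rightarrow> 'a) \<Rightarrow> (nat \<Rightarrow> 'a) \<Rightarrow> (nat \<Rightarrow> 'a)" where
  "diagonal_map g x = (\<lambda>i. g (x (Suc i)))"

definition as_set_valued :: "('a \<Rightarrow> 'b) \<Rightarrow> 'a \<Rightarrow> 'b set" where
  "as_set_valued f x = {f x}"

definition set_comp :: "('b \<Rightarrow> 'c set) \<Rightarrow> ('a \<Rightarrow> 'b set) \<Rightarrow> 'a \<Rightarrow> 'c set" where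
  "set_comp F G x = (\<Union>y\<in>G x. F y)"

text \<open>
  Integer iterates of a map \<open>f\<close> of \<open>X\<close> onto itself. A negative iterate is the set-valued
  preimage in \<open>X\<close>; for a homeomorphism of \<open>X\<close> it is the singleton of the
  corresponding iterate of the inverse homeomorphism.
\<close>
definition int_iterate :: "'a set \<Rightarrow> ('a \<Rightarrow> 'a) \<Rightarrow> int \<Rightarrow> 'a \<Rightarrow> 'a set" where
  "int_iterate X f k x =
     (if k \<ge> 0 then {(f ^^ nat k) x} else {y \<in> X. (f ^^ nat (- k)) y = x})"

text \<open>
  The space is a carrier \<open>X\<close> with a metric \<open>d\<close> given explicitly. Orbits are lists,
  indexed from 0.
\<close>
definition orbits :: "'a set \<Rightarrow> ('a \<Rightarrow> 'a set) \<Rightarrow> nat \<Rightarrow> 'a list set" where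
  "orbits X F n =
     {xs. length xs = n \<and> set xs \<subseteq> X \<and> (\<forall>i. Suc i < n \<longrightarrow> xs ! Suc i \<in> F (xs ! i))}"

definition separated_orbits ::
    "'a set \<Rightarrow> ('a \<Rightarrow> 'a \<Rightarrow> real) \<Rightarrow> ('a \<Rightarrow> 'a set) \<Rightarrow> nat \<Rightarrow> real \<Rightarrow> 'a list set \<Rightarrow> bool" where
  "separated_orbits X d F n \<epsilon> S \<longleftrightarrow>
     S \<subseteq> orbits X F n \<and>
     (\<forall>xs\<in>S. \<forall>ys\<in>S. xs \<noteq> ys \<longrightarrow> (\<exists>i<n. d (xs ! i) (ys ! i) \<ge> \<epsilon>))"

text \<open>
  The largest cardinality of a separated set. For \<open>\<epsilon> > 0\<close> it is attained and finite when
  \<open>(X, d)\<close> is compact. Since \<^const>\<open>card\<close> is 0 on infinite sets, the supremum runs over finite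
  sets, and so is \<open>\<infinity>\<close> whenever an infinite separated set exists.
\<close>
definition separation_number ::
    "'a set \<Rightarrow> ('a \<Rightarrow> 'a \<Rightarrow> real) \<Rightarrow> ('a \<Rightarrow> 'a set) \<Rightarrow> nat \<Rightarrow> real \<Rightarrow> enat" where
  "separation_number X d F n \<epsilon> =
     (SUP S\<in>{S. finite S \<and> separated_orbits X d F n \<epsilon> S}. enat (card S))"

text \<open>The value at 0, which is \<open>ln 0 = 0\<close>, only matters for the empty space.\<close>
definition ln_enat :: "enat \<Rightarrow> ereal" where
  "ln_enat N = (case N of enat k \<Rightarrow> ereal (ln (real k)) | \<infinity> \<Rightarrow> \<infinity>)"

definition entropy :: "'a set \<Rightarrow> ('a \<Rightarrow> 'a \<Rightarrow> real) \<Rightarrow> ('a \<Rightarrow> 'a set) \<Rightarrow> ereal" where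
  "entropy X d F =
     Lim (at_right 0) (\<lambda>\<epsilon>. limsup (\<lambda>n. ln_enat (separation_number X d F n \<epsilon>) / ereal (real n)))"

end

theory Submission
  imports Defs
begin

text \<open>
  Write \<open>F = h^(b-a) \<circ> \<phi>^(m-n)\<close> and let \<open>L\<close> be the inverse limit. Since \<open>f\<close> and \<open>g\<close> are built
  from commuting maps, cancelling their common part gives \<open>g z \<in> F (f z)\<close> for every point
  \<open>z\<close>. With \<open>z = x (M+1)\<close> this says that along an orbit of the diagonal map \<open>G\<close> each single
  coordinate \<open>M\<close> moves along an orbit of \<open>F\<close>. So the orbits of \<open>G\<close> project to orbits of \<open>F\<close>,
  and equality of the entropies needs two things.

  \<^item> Projection must not lose separation. By compactness of \<open>L\<close>, points that are \<open>\<epsilon>\<close> apart in \<open>L\<close>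
    are a definite amount apart in one of finitely many coordinates, and, because coordinate
    \<open>i\<close> is the image of coordinate \<open>M \<ge> i\<close> under an iterate of \<open>f\<close>, also in a single sufficiently
    late coordinate (\<open>late_coordinate_determines_metric\<close>). Projecting to that coordinate bounds
    the entropy of \<open>G\<close> by that of \<open>F\<close>.

  \<^item> Every finite orbit of \<open>F\<close> must be the coordinate-0 trace of an orbit of \<open>G\<close>. If \<open>m \<ge> n\<close>, then
    \<open>F\<close> is a map \<open>k\<close> with \<open>g = k \<circ> f\<close>, and any point of \<open>L\<close> over the first point of the orbit will
    do (\<open>lift_orbit_of_map\<close>). If \<open>m < n\<close>, then \<open>F\<close> takes preimages under a map \<open>p\<close> with
    \<open>f = p \<circ> g\<close>; now the last point of the orbit determines the others, and one prescribes a
    late coordinate of the point of \<open>L\<close> instead (\<open>lift_orbit_of_preimages\<close>). Coordinate 0 is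
    uniformly continuous on \<open>L\<close>, so lifted orbits stay separated, which gives the other bound.

  Both comparisons change \<open>\<epsilon>\<close> only by an amount independent of the length of the orbits, so they
  disappear in the limit \<open>\<epsilon> \<rightarrow> 0\<close>. The metric \<open>D\<close> enters through its topology alone.
\<close>

section \<open>Comparing separation numbers and entropies\<close>

lemma ln_enat_mono:
  assumes "N \<le> M"
  shows "ln_enat N \<le> ln_enat M"
proof (cases M)
  case (enat k)
  with assms obtain j where j: "N = enat j" "j \<le> k"
    by (cases N) auto
  have "ln (real j) \<le> ln (real k)"
  proof (cases "j = 0")
    case True
    then show ?thesis by (cases "k = 0") auto
  next
    case False
    then show ?thesis using j by simp
  qed
  then show ?thesis using enat j by (simp add: ln_enat_def)
qed (simp add: ln_enat_def)

text \<open>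
  A transformation of orbits that preserves separation is injective on every separated set,
  since a point is never far from itself; hence it transports separated sets without changing
  their size.
\<close>
lemma separation_number_le:
  assumes T: "\<And>xs. xs \<in> orbits X F N \<Longrightarrow> T xs \<in> orbits Y H N"
    and small: "\<And>y. y \<in> Y \<Longrightarrow> e y y < \<delta>"
    and sep: "\<And>xs ys i. \<lbrakk>xs \<in> orbits X F N; ys \<in> orbits X F N; i < N; \<epsilon> \<le> d (xs ! i) (ys ! i)\<rbrakk>
      \<Longrightarrow> \<exists>j<N. \<delta> \<le> e (T xs ! j) (T ys ! j)"
  shows "separation_number X d F N \<epsilon> \<le> separation_number Y e H N \<delta>"
  unfolding separation_number_def
proof (rule SUP_mono)
  fix S assume "S \<in> {S. finite S \<and> separated_orbits X d F N \<epsilon> S}"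
  then have fin: "finite S" and sub: "S \<subseteq> orbits X F N"
    and S: "\<And>xs ys. \<lbrakk>xs \<in> S; ys \<in> S; xs \<noteq> ys\<rbrakk> \<Longrightarrow> \<exists>i<N. \<epsilon> \<le> d (xs ! i) (ys ! i)"
    by (auto simp: separated_orbits_def)
  have TS: "\<exists>j<N. \<delta> \<le> e (T xs ! j) (T ys ! j)" if "xs \<in> S" "ys \<in> S" "xs \<noteq> ys" for xs ys
    using S[OF that] sep sub that by blast
  have "inj_on T S"
  proof (rule inj_onI, rule ccontr)
    fix xs ys assume xy: "xs \<in> S" "ys \<in> S" "T xs = T ys" "xs \<noteq> ys"
    then obtain j where j: "j < N" "\<delta> \<le> e (T xs ! j) (T xs ! j)"
      using TS by metis
    have "T xs \<in> orbits Y H N" using T sub xy by blast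
    then have "T xs ! j \<in> Y"
      using j(1) by (auto simp: orbits_def dest: nth_mem)
    then show False using small j(2) by fastforce
  qed
  then have "card (T ` S) = card S" by (rule card_image)
  moreover have "separated_orbits Y e H N \<delta> (T ` S)"
    unfolding separated_orbits_def using T sub by (auto intro!: TS)
  ultimately show "\<exists>S'\<in>{S. finite S \<and> separated_orbits Y e H N \<delta> S}. enat (card S) \<le> enat (card S')"
    using fin by (intro bexI[of _ "T ` S"]) auto
qed

lemma separation_number_antimono:
  assumes "\<delta> \<le> \<epsilon>"
  shows "separation_number X d F N \<epsilon> \<le> separation_number X d F N \<delta>"
  unfolding separation_number_def separated_orbits_def
  using assms by (intro SUP_subset_mono) (fastforce intro: order_trans)+

lemma Lim_at_right_antimono:
  fixes A :: "real \<Rightarrow> ereal"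
  assumes A: "\<And>x y. \<lbrakk>0 < x; x \<le> y\<rbrakk> \<Longrightarrow> A y \<le> A x"
  shows "Lim (at_right 0) A = (SUP x\<in>{0<..}. A x)"
proof (rule tendsto_Lim)
  show "(A \<longlongrightarrow> (SUP x\<in>{0<..}. A x)) (at_right 0)"
  proof (rule order_tendstoI)
    fix l assume "l < (SUP x\<in>{0<..}. A x)"
    then obtain x where x: "0 < x" "l < A x" by (auto simp: less_SUP_iff)
    have "\<forall>\<^sub>F y in at_right 0. 0 < y \<and> y < x"
      using x(1) by (auto simp: eventually_at_right_field)
    then show "\<forall>\<^sub>F y in at_right 0. l < A y"
      by eventually_elim (use x A in \<open>meson less_imp_le less_le_trans\<close>)
  next
    fix u assume "(SUP x\<in>{0<..}. A x) < u"
    moreover have "\<forall>\<^sub>F y in at_right (0::real). 0 < y"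
      by (simp add: eventually_at_right_less)
    ultimately show "\<forall>\<^sub>F y in at_right 0. A y < u"
      by (auto elim!: eventually_mono intro: le_less_trans[OF SUP_upper])
  qed
qed simp

lemma limsup_separation_mono:
  assumes "\<And>N. 0 < N \<Longrightarrow> separation_number X d F N \<epsilon> \<le> separation_number Y e H N \<delta>"
  shows "limsup (\<lambda>N. ln_enat (separation_number X d F N \<epsilon>) / ereal (real N))
    \<le> limsup (\<lambda>N. ln_enat (separation_number Y e H N \<delta>) / ereal (real N))"
proof (rule Limsup_mono)
  show "\<forall>\<^sub>F N in sequentially. ln_enat (separation_number X d F N \<epsilon>) / ereal (real N)
      \<le> ln_enat (separation_number Y e H N \<delta>) / ereal (real N)"
    using eventually_gt_at_top[of "0::nat"]
    by eventually_elim (simp add: assms ln_enat_mono)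
qed

text \<open>
  The exponential growth rate of the separation numbers increases as \<open>\<epsilon>\<close> decreases, so the limit
  defining the entropy exists and is a supremum. This makes the comparison in \<open>entropy_le\<close>
  possible although \<open>\<delta>\<close> depends on \<open>\<epsilon>\<close> in an unknown way.
\<close>
lemma entropy_eq_SUP:
  "entropy X d F =
    (SUP \<epsilon>\<in>{0<..}. limsup (\<lambda>N. ln_enat (separation_number X d F N \<epsilon>) / ereal (real N)))"
  unfolding entropy_def
  by (intro Lim_at_right_antimono limsup_separation_mono separation_number_antimono)

lemma entropy_le:
  assumes "\<And>\<epsilon>. 0 < \<epsilon> \<Longrightarrow>
    \<exists>\<delta>>0. \<forall>N>0. separation_number X d F N \<epsilon> \<le> separation_number Y e H N \<delta>"
  shows "entropy X d F \<le> entropy Y e H"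
  unfolding entropy_eq_SUP
proof (rule SUP_mono)
  fix \<epsilon> :: real assume "\<epsilon> \<in> {0<..}"
  then obtain \<delta> where "\<delta> > 0"
    "\<And>N. 0 < N \<Longrightarrow> separation_number X d F N \<epsilon> \<le> separation_number Y e H N \<delta>"
    using assms by auto
  then show "\<exists>\<delta>\<in>{0<..}. limsup (\<lambda>N. ln_enat (separation_number X d F N \<epsilon>) / ereal (real N))
      \<le> limsup (\<lambda>N. ln_enat (separation_number Y e H N \<delta>) / ereal (real N))"
    by (intro bexI[of _ \<delta>] limsup_separation_mono) auto
qed

section \<open>Inverse limits\<close>

lemma inverse_limitD:
  assumes "x \<in> inverse_limit X f"
  shows "x i \<in> X" "f (x (Suc i)) = x i"
  using assms by (auto simp: inverse_limit_def)

text \<open>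
  For coordinate 0, choose preimages one after another. For later coordinates, extend a point
  with the given value one place earlier by putting its \<open>f\<close>-image in front.
\<close>
lemma inverse_limit_coordinate_surj:
  assumes f: "f ` X = X" and z: "z \<in> X"
  shows "\<exists>x\<in>inverse_limit X f. x N = z"
  using z
proof (induction N arbitrary: z)
  case 0
  have "\<exists>x. x 0 = z \<and> (\<forall>i. x i \<in> X \<and> f (x (Suc i)) = x i)"
  proof -
    have "\<exists>x. \<forall>i. (x i \<in> X \<and> (i = 0 \<longrightarrow> x i = z)) \<and> f (x (Suc i)) = x i"
    proof (rule dependent_nat_choice)
      show "\<exists>y. y \<in> X \<and> ((0::nat) = 0 \<longrightarrow> y = z)" using 0 by blast
    next
      fix y and i :: nat assume "y \<in> X \<and> (i = 0 \<longrightarrow> y = z)"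
      then show "\<exists>w. (w \<in> X \<and> (Suc i = 0 \<longrightarrow> w = z)) \<and> f w = y"
        using f by (metis imageE nat.distinct(1))
    qed
    then show ?thesis by blast
  qed
  then show ?case by (auto simp: inverse_limit_def)
next
  case (Suc N)
  then obtain x where x: "x \<in> inverse_limit X f" "x N = z" by blast
  let ?y = "case_nat (f (x 0)) x"
  have "?y \<in> inverse_limit X f"
    using x(1) f by (auto simp: inverse_limit_def split: nat.split)
  then show ?case using x(2) by (intro bexI[of _ ?y]) auto
qed

lemma inverse_limit_funpow:
  assumes "x \<in> inverse_limit X f"
  shows "(f ^^ j) (x (i + j)) = x i"
  using assms
proof (induction j arbitrary: i)
  case (Suc j)
  then show ?case
    using Suc.IH[of "Suc i"] by (simp add: inverse_limitD)
qed simp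

lemma diagonal_map_in_inverse_limit:
  assumes "g ` X \<subseteq> X" "\<And>x. x \<in> X \<Longrightarrow> f (g x) = g (f x)" "x \<in> inverse_limit X f"
  shows "diagonal_map g x \<in> inverse_limit X f"
  using assms by (auto simp: inverse_limit_def diagonal_map_def)

lemma funpow_diagonal_map: "(diagonal_map g ^^ j) x i = (g ^^ j) (x (i + j))"
  by (induction j arbitrary: i) (simp_all add: diagonal_map_def)

text \<open>
  The inverse limit is closed in a compact product, because each of the equations defining it
  compares two continuous maps into a Hausdorff space.
\<close>
lemma compact_space_inverse_limit:
  fixes X :: "'a::metric_space set"
  assumes "compact X" "continuous_on X f" "f ` X \<subseteq> X"
  shows "compact_space (inverse_limit_topology X f)"
proof -
  let ?P = "product_topology (\<lambda>_. top_of_set X) (UNIV :: nat set)"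
  have top: "topspace ?P = {x. \<forall>i. x i \<in> X}" by (auto simp: PiE_def Pi_def)
  have cmp: "compact_space ?P"
    using assms(1) by (simp add: compact_space_product_topology compact_space_subtopology)
  have proj: "continuous_map ?P (top_of_set X) (\<lambda>x. x i)" for i
    by (rule continuous_map_product_projection) simp
  have cf: "continuous_map (top_of_set X) (top_of_set X) f"
    using assms by (auto simp: continuous_map_subtopology_eu)
  have "closedin ?P {x \<in> topspace ?P. f (x (Suc i)) = x i}" for i
  proof (rule closedin_continuous_maps_eq)
    show "Hausdorff_space (top_of_set X)" by (simp add: Hausdorff_space_subtopology)
    show "continuous_map ?P (top_of_set X) (\<lambda>x. f (x (Suc i)))"
      using continuous_map_compose[OF proj cf] by (simp add: o_def)
  qed (rule proj)
  then have "closedin ?P (\<Inter>i. {x \<in> topspace ?P. f (x (Suc i)) = x i})"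
    by (intro closedin_INT) auto
  moreover have "(\<Inter>i. {x \<in> topspace ?P. f (x (Suc i)) = x i}) = inverse_limit X f"
    unfolding top by (auto simp: inverse_limit_def)
  ultimately show ?thesis
    using cmp by (simp add: inverse_limit_topology_def compact_space_subtopology closedin_compact_space)
qed

locale metrized_inverse_limit =
  fixes X :: "'a::metric_space set" and f :: "'a \<Rightarrow> 'a"
    and D :: "(nat \<Rightarrow> 'a) \<Rightarrow> (nat \<Rightarrow> 'a) \<Rightarrow> real"
  assumes compact: "compact X"
    and continuous: "continuous_on X f"
    and onto: "f ` X = X"
    and metric: "Metric_space (inverse_limit X f) D"
    and topology: "Metric_space.mtopology (inverse_limit X f) D = inverse_limit_topology X f"
begin

sublocale L: Metric_space "inverse_limit X f" D
  by (rule metric)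

text \<open>
  The common source of the two uniformity statements relating \<open>D\<close> to the coordinates:
  each follows by contradiction, from the limits of a pair of sequences violating it.
\<close>
lemma pair_subsequence_limits:
  fixes \<sigma> \<tau> :: "nat \<Rightarrow> nat \<Rightarrow> 'a"
  assumes \<sigma>: "\<And>k. \<sigma> k \<in> inverse_limit X f" and \<tau>: "\<And>k. \<tau> k \<in> inverse_limit X f"
  obtains x y r where "x \<in> inverse_limit X f" "y \<in> inverse_limit X f" "strict_mono r"
    "(\<lambda>k. D (\<sigma> (r k)) (\<tau> (r k))) \<longlonglongrightarrow> D x y"
    "\<And>i. (\<lambda>k. dist (\<sigma> (r k) i) (\<tau> (r k) i)) \<longlonglongrightarrow> dist (x i) (y i)"
proof -
  have "compactin L.mtopology (inverse_limit X f)"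
    using compact_space_inverse_limit[OF compact continuous] onto topology
    by (metis compact_space_def L.topspace_mtopology order_refl)
  then have seq: "\<exists>l r. l \<in> inverse_limit X f \<and> strict_mono r \<and> limitin L.mtopology (\<rho> \<circ> r) l sequentially"
    if "range \<rho> \<subseteq> inverse_limit X f" for \<rho> :: "nat \<Rightarrow> nat \<Rightarrow> 'a"
    using that by (simp add: L.compactin_sequentially)
  obtain x r where x: "x \<in> inverse_limit X f" "strict_mono r" "limitin L.mtopology (\<sigma> \<circ> r) x sequentially"
    using seq[of \<sigma>] \<sigma> by blast
  obtain y s where y: "y \<in> inverse_limit X f" "strict_mono s"
    "limitin L.mtopology (\<tau> \<circ> r \<circ> s) y sequentially"
    using seq[of "\<tau> \<circ> r"] \<tau> by (metis comp_apply image_subsetI)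
  define q where "q = r \<circ> s"
  have q: "strict_mono q" unfolding q_def using x(2) y(2) by (rule strict_mono_o)
  have xq: "limitin L.mtopology (\<sigma> \<circ> q) x sequentially"
    unfolding q_def o_assoc using y(2) x(3) by (rule limitin_subsequence)
  have yq: "limitin L.mtopology (\<tau> \<circ> q) y sequentially"
    using y(3) by (simp add: q_def o_assoc)
  have "(\<lambda>k. D (\<sigma> (q k)) x) \<longlonglongrightarrow> 0" "(\<lambda>k. D (\<tau> (q k)) y) \<longlonglongrightarrow> 0"
    using xq yq by (simp_all add: L.limitin_metric_dist_null o_def)
  then have null: "(\<lambda>k. D (\<sigma> (q k)) x + D (\<tau> (q k)) y) \<longlonglongrightarrow> 0"
    using tendsto_add by fastforce
  have "\<bar>D (\<sigma> (q k)) (\<tau> (q k)) - D x y\<bar> \<le> D (\<sigma> (q k)) x + D (\<tau> (q k)) y" for k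
    using L.triangle[of "\<sigma> (q k)" x "\<tau> (q k)"] L.triangle[of x y "\<tau> (q k)"]
      L.triangle[of x "\<sigma> (q k)" y] L.triangle[of "\<sigma> (q k)" "\<tau> (q k)" y]
      x(1) y(1) \<sigma> \<tau> L.commute[of x "\<sigma> (q k)"] L.commute[of y "\<tau> (q k)"] by fastforce
  then have "(\<lambda>k. D (\<sigma> (q k)) (\<tau> (q k)) - D x y) \<longlonglongrightarrow> 0"
    by (intro Lim_null_comparison[OF _ null]) auto
  then have lim: "(\<lambda>k. D (\<sigma> (q k)) (\<tau> (q k))) \<longlonglongrightarrow> D x y"
    by (rule LIM_zero_cancel)
  have proj: "continuous_map L.mtopology euclidean (\<lambda>x. x i)" for i
    unfolding topology inverse_limit_topology_def
    using continuous_map_product_projection[of i UNIV "\<lambda>_. top_of_set X"]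
    by (auto intro: continuous_map_from_subtopology simp: continuous_map_in_subtopology)
  have "(\<lambda>k. \<sigma> (q k) i) \<longlonglongrightarrow> x i" "(\<lambda>k. \<tau> (q k) i) \<longlonglongrightarrow> y i" for i
    using continuous_map_limit[OF proj xq, of i] continuous_map_limit[OF proj yq, of i]
    by (simp_all add: o_def)
  then have "(\<lambda>k. dist (\<sigma> (q k) i) (\<tau> (q k) i)) \<longlonglongrightarrow> dist (x i) (y i)" for i
    by (rule tendsto_dist)
  then show ?thesis using that x(1) y(1) q lim by blast
qed

lemma coordinate_uniformly_continuous:
  assumes "\<epsilon> > 0"
  shows "\<exists>\<delta>>0. \<forall>x\<in>inverse_limit X f. \<forall>y\<in>inverse_limit X f. D x y < \<delta> \<longrightarrow> dist (x i) (y i) < \<epsilon>"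
proof (rule ccontr)
  assume not: "\<not> ?thesis"
  have "\<exists>x y. x \<in> inverse_limit X f \<and> y \<in> inverse_limit X f
      \<and> D x y < inverse (real (Suc k)) \<and> \<epsilon> \<le> dist (x i) (y i)" for k
  proof -
    have "\<forall>\<delta>>0. \<exists>x\<in>inverse_limit X f. \<exists>y\<in>inverse_limit X f. D x y < \<delta> \<and> \<epsilon> \<le> dist (x i) (y i)"
      using not by (simp only: not_less[symmetric]) blast
    moreover have "0 < inverse (real (Suc k))" by simp
    ultimately show ?thesis by blast
  qed
  then obtain \<sigma> \<tau> where st: "\<And>k. \<sigma> k \<in> inverse_limit X f" "\<And>k. \<tau> k \<in> inverse_limit X f"
    and small: "\<And>k. D (\<sigma> k) (\<tau> k) < inverse (real (Suc k))"
    and big: "\<And>k. \<epsilon> \<le> dist (\<sigma> k i) (\<tau> k i)"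
    by metis
  obtain x y r where xy: "x \<in> inverse_limit X f" "y \<in> inverse_limit X f" and r: "strict_mono r"
    and D: "(\<lambda>k. D (\<sigma> (r k)) (\<tau> (r k))) \<longlonglongrightarrow> D x y"
    and d: "\<And>i. (\<lambda>k. dist (\<sigma> (r k) i) (\<tau> (r k) i)) \<longlonglongrightarrow> dist (x i) (y i)"
    by (rule pair_subsequence_limits[OF st]) (rule that)
  have "(\<lambda>k. inverse (real (Suc (r k)))) \<longlonglongrightarrow> 0"
    using LIMSEQ_subseq_LIMSEQ[OF LIMSEQ_inverse_real_of_nat r] by (simp add: o_def)
  then have "D x y \<le> 0"
    by (rule LIMSEQ_le[OF D]) (use small less_imp_le in blast)
  then have "x = y" using xy L.zero L.nonneg by (meson antisym)
  moreover have "\<epsilon> \<le> dist (x i) (y i)"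
    by (rule LIMSEQ_le_const[OF d]) (use big in blast)
  ultimately show False using assms by simp
qed

text \<open>
  Counterexamples would have limits that agree in every coordinate, hence equal, although
  they are at distance at least \<open>\<epsilon>\<close>.
\<close>
lemma coordinates_determine_metric:
  assumes "\<epsilon> > 0"
  shows "\<exists>N. \<exists>\<delta>>0. \<forall>x\<in>inverse_limit X f. \<forall>y\<in>inverse_limit X f.
    (\<forall>i\<le>N. dist (x i) (y i) < \<delta>) \<longrightarrow> D x y < \<epsilon>"
proof (rule ccontr)
  assume not: "\<not> ?thesis"
  have "\<exists>x y. x \<in> inverse_limit X f \<and> y \<in> inverse_limit X f
      \<and> (\<forall>i\<le>k. dist (x i) (y i) < inverse (real (Suc k))) \<and> \<epsilon> \<le> D x y" for k
  proof -
    have "\<forall>N. \<forall>\<delta>>0. \<exists>x\<in>inverse_limit X f. \<exists>y\<in>inverse_limit X f.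
        (\<forall>i\<le>N. dist (x i) (y i) < \<delta>) \<and> \<epsilon> \<le> D x y"
      using not by (simp only: not_less[symmetric]) blast
    moreover have "0 < inverse (real (Suc k))" by simp
    ultimately show ?thesis by blast
  qed
  then obtain \<sigma> \<tau> where st: "\<And>k. \<sigma> k \<in> inverse_limit X f" "\<And>k. \<tau> k \<in> inverse_limit X f"
    and small: "\<And>k i. i \<le> k \<Longrightarrow> dist (\<sigma> k i) (\<tau> k i) < inverse (real (Suc k))"
    and big: "\<And>k. \<epsilon> \<le> D (\<sigma> k) (\<tau> k)"
    by metis
  obtain x y r where xy: "x \<in> inverse_limit X f" "y \<in> inverse_limit X f" and r: "strict_mono r"
    and D: "(\<lambda>k. D (\<sigma> (r k)) (\<tau> (r k))) \<longlonglongrightarrow> D x y"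
    and d: "\<And>i. (\<lambda>k. dist (\<sigma> (r k) i) (\<tau> (r k) i)) \<longlonglongrightarrow> dist (x i) (y i)"
    by (rule pair_subsequence_limits[OF st]) (rule that)
  have null: "(\<lambda>k. inverse (real (Suc (r k)))) \<longlonglongrightarrow> 0"
    using LIMSEQ_subseq_LIMSEQ[OF LIMSEQ_inverse_real_of_nat r] by (simp add: o_def)
  have "x i = y i" for i
  proof -
    have "\<exists>K. \<forall>k\<ge>K. dist (\<sigma> (r k) i) (\<tau> (r k) i) \<le> inverse (real (Suc (r k)))"
    proof (intro exI[of _ i] allI impI)
      fix k assume "i \<le> k"
      then have "i \<le> r k" using seq_suble[OF r, of k] by simp
      then show "dist (\<sigma> (r k) i) (\<tau> (r k) i) \<le> inverse (real (Suc (r k)))"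
        using small less_imp_le by blast
    qed
    then have "dist (x i) (y i) \<le> 0"
      by (rule LIMSEQ_le[OF d null])
    then show ?thesis by simp
  qed
  then have "D x y = 0" using xy L.zero by blast
  moreover have "\<epsilon> \<le> D x y"
    by (rule LIMSEQ_le_const[OF D]) (use big in blast)
  ultimately show False using assms by simp
qed

lemma funpow_uniformly_continuous:
  assumes "\<epsilon> > 0"
  shows "\<exists>\<delta>>0. \<forall>x\<in>X. \<forall>y\<in>X. dist x y < \<delta> \<longrightarrow> (\<forall>j\<le>N. dist ((f ^^ j) x) ((f ^^ j) y) < \<epsilon>)"
proof (induction N)
  case 0
  then show ?case using assms by auto
next
  case (Suc N)
  then obtain \<delta> where \<delta>: "\<delta> > 0"
    "\<And>x y j. \<lbrakk>x \<in> X; y \<in> X; dist x y < \<delta>; j \<le> N\<rbrakk> \<Longrightarrow> dist ((f ^^ j) x) ((f ^^ j) y) < \<epsilon>"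
    by blast
  have "uniformly_continuous_on X f"
    using compact_uniformly_continuous continuous compact by blast
  then obtain \<gamma> where \<gamma>: "\<gamma> > 0" "\<And>x y. \<lbrakk>x \<in> X; y \<in> X; dist x y < \<gamma>\<rbrakk> \<Longrightarrow> dist (f x) (f y) < \<delta>"
    using \<delta>(1) unfolding uniformly_continuous_on_def by metis
  have "dist ((f ^^ j) x) ((f ^^ j) y) < \<epsilon>"
    if "x \<in> X" "y \<in> X" "dist x y < min \<epsilon> \<gamma>" "j \<le> Suc N" for x y j
  proof (cases j)
    case 0
    then show ?thesis using that by simp
  next
    case (Suc i)
    then show ?thesis
      using that \<delta>(2)[of "f x" "f y" i] \<gamma>(2)[of x y] onto by (auto simp: funpow_swap1)
  qed
  then show ?case using assms \<gamma>(1) by (intro exI[of _ "min \<epsilon> \<gamma>"]) auto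
qed

text \<open>
  Coordinate \<open>N\<close> controls all earlier ones, which are its images under the iterates of \<open>f\<close>.
\<close>
lemma late_coordinate_determines_metric:
  assumes "\<epsilon> > 0"
  shows "\<exists>N. \<exists>\<delta>>0. \<forall>x\<in>inverse_limit X f. \<forall>y\<in>inverse_limit X f.
    dist (x N) (y N) < \<delta> \<longrightarrow> D x y < \<epsilon>"
proof -
  obtain N \<gamma> where \<gamma>: "\<gamma> > 0" "\<And>x y. \<lbrakk>x \<in> inverse_limit X f; y \<in> inverse_limit X f;
      \<forall>i\<le>N. dist (x i) (y i) < \<gamma>\<rbrakk> \<Longrightarrow> D x y < \<epsilon>"
    using coordinates_determine_metric[OF assms] by blast
  obtain \<delta> where \<delta>: "\<delta> > 0" "\<And>x y j. \<lbrakk>x \<in> X; y \<in> X; dist x y < \<delta>; j \<le> N\<rbrakk>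
      \<Longrightarrow> dist ((f ^^ j) x) ((f ^^ j) y) < \<gamma>"
    using funpow_uniformly_continuous[OF \<gamma>(1)] by metis
  have "D x y < \<epsilon>" if x: "x \<in> inverse_limit X f" and y: "y \<in> inverse_limit X f"
    and xy: "dist (x N) (y N) < \<delta>" for x y
  proof (rule \<gamma>(2)[OF x y], intro allI impI)
    fix i assume "i \<le> N"
    then show "dist (x i) (y i) < \<gamma>"
      using \<delta>(2)[of "x N" "y N" "N - i"] xy inverse_limitD(1)[OF x] inverse_limitD(1)[OF y]
        inverse_limit_funpow[OF x, of "N - i" i] inverse_limit_funpow[OF y, of "N - i" i]
      by simp
  qed
  then show ?thesis using \<delta>(1) by blast
qed

section \<open>The entropy of a diagonal map\<close>

text \<open>
  The two hypotheses on \<open>F\<close> are what makes orbits project and lift: \<open>step\<close> lets every coordinate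
  of an orbit of the diagonal map be an orbit of \<open>F\<close>, and, since coordinate 0 of the \<open>j\<close>-th
  iterate of the diagonal map is \<open>(g ^^ j) (x j)\<close>, \<open>lift\<close> says that each orbit of \<open>F\<close> arises in
  this way from coordinate 0.
\<close>
lemma entropy_diagonal_map:
  assumes gX: "g ` X \<subseteq> X" and comm: "\<And>x. x \<in> X \<Longrightarrow> f (g x) = g (f x)"
    and step: "\<And>z. z \<in> X \<Longrightarrow> g z \<in> F (f z)"
    and lift: "\<And>N xs. \<lbrakk>N > 0; xs \<in> orbits X F N\<rbrakk>
      \<Longrightarrow> \<exists>x\<in>inverse_limit X f. \<forall>j<N. (g ^^ j) (x j) = xs ! j"
  shows "entropy (inverse_limit X f) D (as_set_valued (diagonal_map g)) = entropy X dist F"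
proof (rule antisym)
  let ?L = "inverse_limit X f" and ?G = "as_set_valued (diagonal_map g)"
  show "entropy ?L D ?G \<le> entropy X dist F"
  proof (rule entropy_le)
    fix \<epsilon> :: real assume "\<epsilon> > 0"
    then obtain M \<delta> where \<delta>: "\<delta> > 0"
      "\<And>x y. \<lbrakk>x \<in> ?L; y \<in> ?L; dist (x M) (y M) < \<delta>\<rbrakk> \<Longrightarrow> D x y < \<epsilon>"
      using late_coordinate_determines_metric by metis
    have "separation_number ?L D ?G N \<epsilon> \<le> separation_number X dist F N \<delta>" for N
    proof (rule separation_number_le[where T = "map (\<lambda>x. x M)"])
      fix xs assume xs: "xs \<in> orbits ?L ?G N"
      have "(xs ! Suc i) M \<in> F ((xs ! i) M)" if "Suc i < N" for i
      proof -
        have "xs ! i \<in> ?L" using xs that by (auto simp: orbits_def)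
        moreover have "xs ! Suc i = diagonal_map g (xs ! i)"
          using xs that by (auto simp: orbits_def as_set_valued_def)
        ultimately show ?thesis
          using step[of "(xs ! i) (Suc M)"] by (simp add: diagonal_map_def inverse_limitD)
      qed
      then show "map (\<lambda>x. x M) xs \<in> orbits X F N"
        using xs by (auto simp: orbits_def inverse_limitD)
    next
      fix xs ys i assume "xs \<in> orbits ?L ?G N" "ys \<in> orbits ?L ?G N" "i < N" "\<epsilon> \<le> D (xs ! i) (ys ! i)"
      moreover from this have "xs ! i \<in> ?L" "ys ! i \<in> ?L" "length xs = N" "length ys = N"
        by (auto simp: orbits_def)
      ultimately show "\<exists>j<N. \<delta> \<le> dist (map (\<lambda>x. x M) xs ! j) (map (\<lambda>x. x M) ys ! j)"
        using \<delta>(2) by (intro exI[of _ i]) (auto simp: not_less[symmetric])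
    qed (use \<delta> in simp)
    then show "\<exists>\<delta>>0. \<forall>N>0. separation_number ?L D ?G N \<epsilon> \<le> separation_number X dist F N \<delta>"
      using \<delta>(1) by blast
  qed
  show "entropy X dist F \<le> entropy ?L D ?G"
  proof (rule entropy_le)
    fix \<epsilon> :: real assume "\<epsilon> > 0"
    then obtain \<delta> where \<delta>: "\<delta> > 0"
      "\<And>x y. \<lbrakk>x \<in> ?L; y \<in> ?L; D x y < \<delta>\<rbrakk> \<Longrightarrow> dist (x 0) (y 0) < \<epsilon>"
      using coordinate_uniformly_continuous[of \<epsilon> 0] by blast
    have "separation_number X dist F N \<epsilon> \<le> separation_number ?L D ?G N \<delta>" if "N > 0" for N
    proof -
      obtain start where start: "\<And>xs. xs \<in> orbits X F N \<Longrightarrow> start xs \<in> ?L"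
        "\<And>xs j. \<lbrakk>xs \<in> orbits X F N; j < N\<rbrakk> \<Longrightarrow> (g ^^ j) (start xs j) = xs ! j"
      proof -
        have "\<forall>xs\<in>orbits X F N. \<exists>x\<in>?L. \<forall>j<N. (g ^^ j) (x j) = xs ! j"
          using lift[OF \<open>N > 0\<close>] by blast
        then obtain start where "\<forall>xs\<in>orbits X F N. start xs \<in> ?L \<and> (\<forall>j<N. (g ^^ j) (start xs j) = xs ! j)"
          by metis
        then show ?thesis using that by blast
      qed
      define T where "T xs = map (\<lambda>j. (diagonal_map g ^^ j) (start xs)) [0..<N]" for xs
      have inL: "(diagonal_map g ^^ j) x \<in> ?L" if "x \<in> ?L" for j x
        using that by (induction j) (simp_all add: diagonal_map_in_inverse_limit gX comm)
      have T0: "(T xs ! j) 0 = xs ! j" if "xs \<in> orbits X F N" "j < N" for xs j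
        using that start(2) by (simp add: T_def funpow_diagonal_map)
      have TL: "T xs ! j \<in> ?L" if "xs \<in> orbits X F N" "j < N" for xs j
        using that start(1) inL by (simp add: T_def)
      show ?thesis
      proof (rule separation_number_le[where T = T])
        fix xs assume "xs \<in> orbits X F N"
        then show "T xs \<in> orbits ?L ?G N"
          using start(1) inL by (auto simp: T_def orbits_def as_set_valued_def)
      next
        fix xs ys i
        assume "xs \<in> orbits X F N" "ys \<in> orbits X F N" "i < N" "\<epsilon> \<le> dist (xs ! i) (ys ! i)"
        then show "\<exists>j<N. \<delta> \<le> D (T xs ! j) (T ys ! j)"
          using \<delta>(2)[OF TL TL, of xs i ys i] T0 by (intro exI[of _ i]) (auto simp: not_less[symmetric])
      qed (use \<delta> L.mdist_zero in simp)
    qed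
    then show "\<exists>\<delta>>0. \<forall>N>0. separation_number X dist F N \<epsilon> \<le> separation_number ?L D ?G N \<delta>"
      using \<delta>(1) by blast
  qed
qed

end

section \<open>Lifting orbits\<close>

lemma funpow_in:
  assumes "u ` X \<subseteq> X" "x \<in> X"
  shows "(u ^^ j) x \<in> X"
  using assms by (induction j) auto

lemma funpow_image:
  assumes "u ` X = X"
  shows "(u ^^ j) ` X = X"
  using assms by (induction j) (simp_all add: image_comp[symmetric] del: o_apply)

lemma funpow_commute_on:
  assumes "u ` X \<subseteq> X" "\<And>x. x \<in> X \<Longrightarrow> v (u x) = u (v x)" "x \<in> X"
  shows "v ((u ^^ j) x) = (u ^^ j) (v x)"
  using assms by (induction j) (auto simp: funpow_in)

text \<open>
  When \<open>F\<close> is a map \<open>k\<close>, the first point determines the orbit. Each step replaces one application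
  of \<open>g\<close> and one coordinate shift by one application of \<open>k\<close>, because \<open>g = k \<circ> f\<close>.
\<close>
lemma lift_orbit_of_map:
  assumes f: "f ` X = X" and k: "k ` X \<subseteq> X"
    and g: "\<And>x. x \<in> X \<Longrightarrow> g x = k (f x)" and comm: "\<And>x. x \<in> X \<Longrightarrow> k (g x) = g (k x)"
    and F: "\<And>x. x \<in> X \<Longrightarrow> F x = {k x}"
    and N: "N > 0" and xs: "xs \<in> orbits X F N"
  shows "\<exists>x\<in>inverse_limit X f. \<forall>j<N. (g ^^ j) (x j) = xs ! j"
proof -
  have inX: "xs ! j \<in> X" if "j < N" for j
    using xs that by (auto simp: orbits_def)
  have next_pt: "xs ! Suc j = k (xs ! j)" if "Suc j < N" for j
    using xs that F inX[of j] by (auto simp: orbits_def)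
  obtain x where x: "x \<in> inverse_limit X f" "x 0 = xs ! 0"
    using inverse_limit_coordinate_surj[OF f inX[OF N]] by blast
  have gX: "g ` X \<subseteq> X" using f g k by auto
  have "(g ^^ j) (x j) = xs ! j" if "j < N" for j
    using that
  proof (induction j)
    case (Suc j)
    have "(g ^^ Suc j) (x (Suc j)) = (g ^^ j) (k (x j))"
      using g[of "x (Suc j)"] inverse_limitD[OF x(1)] by (simp add: funpow_swap1)
    also have "\<dots> = k ((g ^^ j) (x j))"
      using funpow_commute_on[of g X k "x j" j] gX comm inverse_limitD(1)[OF x(1)] by simp
    also have "\<dots> = xs ! Suc j" using Suc next_pt by simp
    finally show ?case .
  qed (use x in simp)
  then show ?thesis using x(1) by blast
qed

text \<open>
  When \<open>F\<close> takes preimages under \<open>p\<close>, it is the last point that determines the orbit. As \<open>g\<close> is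
  onto, coordinate \<open>N - 1\<close> can be chosen so that its image under \<open>g ^^ (N - 1)\<close> is that
  last point; the earlier points are then matched by descending induction, using \<open>f = p \<circ> g\<close>.
\<close>
lemma lift_orbit_of_preimages:
  assumes f: "f ` X = X" and gX: "g ` X = X"
    and fp: "\<And>x. x \<in> X \<Longrightarrow> f x = p (g x)" and comm: "\<And>x. x \<in> X \<Longrightarrow> p (g x) = g (p x)"
    and F: "\<And>x. x \<in> X \<Longrightarrow> F x = {y \<in> X. p y = x}"
    and N: "N > 0" and xs: "xs \<in> orbits X F N"
  shows "\<exists>x\<in>inverse_limit X f. \<forall>j<N. (g ^^ j) (x j) = xs ! j"
proof -
  have inX: "xs ! j \<in> X" if "j < N" for j
    using xs that by (auto simp: orbits_def)
  have prev: "xs ! j = p (xs ! Suc j)" if "Suc j < N" for j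
    using xs that F inX[of j] by (auto simp: orbits_def)
  obtain z where z: "z \<in> X" "(g ^^ (N - 1)) z = xs ! (N - 1)"
    using funpow_image[OF gX, of "N - 1"] inX[of "N - 1"] N by (metis diff_less imageE zero_less_one)
  obtain x where x: "x \<in> inverse_limit X f" "x (N - 1) = z"
    using inverse_limit_coordinate_surj[OF f z(1)] by blast
  have "(g ^^ j) (x j) = xs ! j" if "j \<le> N - 1" for j
    using that
  proof (induction rule: inc_induct)
    case (step j)
    let ?w = "x (Suc j)"
    have w: "?w \<in> X" "g ?w \<in> X" using inverse_limitD(1)[OF x(1)] gX by auto
    have "(g ^^ j) (x j) = (g ^^ j) (p (g ?w))"
      using fp[OF w(1)] inverse_limitD(2)[OF x(1), of j] by simp
    also have "\<dots> = p ((g ^^ j) (g ?w))"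
      using funpow_commute_on[of g X p "g ?w" j] gX comm w by simp
    also have "\<dots> = xs ! j"
      using step prev[of j] by (simp add: funpow_swap1)
    finally show ?case .
  qed (use x z in simp)
  then show ?thesis using x(1) by (intro bexI[of _ x]) auto
qed

section \<open>Integer iterates of a homeomorphism\<close>

lemma inverse_commutes_on:
  assumes "h' ` X \<subseteq> X" "\<And>x. x \<in> X \<Longrightarrow> h' (h x) = x" "\<And>x. x \<in> X \<Longrightarrow> h (h' x) = x"
    and "u ` X \<subseteq> X" "\<And>x. x \<in> X \<Longrightarrow> h (u x) = u (h x)" and x: "x \<in> X"
  shows "h' (u x) = u (h' x)"
proof -
  have "u x = h (u (h' x))" using assms by (metis image_subset_iff)
  then show ?thesis using assms by (metis image_subset_iff)
qed

lemma funpow_inverse_on: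
  assumes "h ` X \<subseteq> X" "\<And>x. x \<in> X \<Longrightarrow> h' (h x) = x" "x \<in> X"
  shows "(h' ^^ j) ((h ^^ j) x) = x"
  using assms
proof (induction j)
  case (Suc j)
  then show ?case
    using funpow_in[OF Suc.prems(1,3), of j] by (simp add: funpow_swap1[of h'])
qed simp

text \<open>
  For a homeomorphism, the set-valued iterate of exponent \<open>b - a\<close> is a map of \<open>X\<close> in either sign,
  characterised by \<open>e \<circ> h^a = h^b\<close>. For a negative exponent it inherits commutation from \<open>h\<close>
  because the inverse of \<open>h\<close> commutes with whatever \<open>h\<close> commutes with.
\<close>
lemma int_iterate_homeomorphism:
  assumes h: "h ` X = X" and h': "h' ` X = X"
    and inv: "\<And>x. x \<in> X \<Longrightarrow> h' (h x) = x" "\<And>x. x \<in> X \<Longrightarrow> h (h' x) = x"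
    and u: "u ` X \<subseteq> X" "\<And>x. x \<in> X \<Longrightarrow> h (u x) = u (h x)"
  shows "\<exists>e. e ` X = X \<and> (\<forall>x\<in>X. int_iterate X h (int b - int a) x = {e x}
    \<and> e ((h ^^ a) x) = (h ^^ b) x \<and> e (u x) = u (e x))"
proof (cases "a \<le> b")
  case True
  then have n: "nat (int b - int a) = b - a" "int b - int a \<ge> 0" by auto
  show ?thesis
  proof (intro exI[of _ "h ^^ (b - a)"] conjI ballI)
    show "(h ^^ (b - a)) ` X = X" using h by (rule funpow_image)
    show "int_iterate X h (int b - int a) x = {(h ^^ (b - a)) x}" for x
      unfolding int_iterate_def n(1) using n(2) by simp
    show "(h ^^ (b - a)) ((h ^^ a) x) = (h ^^ b) x" for x
      using True funpow_add[of "b - a" a h] by (metis comp_apply le_add_diff_inverse2)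
    show "(h ^^ (b - a)) (u x) = u ((h ^^ (b - a)) x)"
      if "x \<in> X" for x
      using funpow_commute_on[of h X u x "b - a"] h u that by simp
  qed
next
  case False
  then have n: "nat (- (int b - int a)) = a - b" "\<not> int b - int a \<ge> 0" by auto
  have pinv: "(h' ^^ j) ((h ^^ j) x) = x" "(h ^^ j) ((h' ^^ j) x) = x" if "x \<in> X" for j x
    using funpow_inverse_on[of h X h' x j] funpow_inverse_on[of h' X h x j] h h' inv that by auto
  show ?thesis
  proof (intro exI[of _ "h' ^^ (a - b)"] conjI ballI)
    show "(h' ^^ (a - b)) ` X = X" using h' by (rule funpow_image)
    show "int_iterate X h (int b - int a) x = {(h' ^^ (a - b)) x}" if "x \<in> X" for x
    proof -
      have "int_iterate X h (int b - int a) x = {y \<in> X. (h ^^ (a - b)) y = x}"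
        unfolding int_iterate_def n(1) using n(2) by simp
      also have "\<dots> = {(h' ^^ (a - b)) x}"
        using that pinv funpow_in[of h' X x] h' by auto
      finally show ?thesis .
    qed
    show "(h' ^^ (a - b)) ((h ^^ a) x) = (h ^^ b) x" if "x \<in> X" for x
    proof -
      have "(h ^^ a) x = (h ^^ (a - b)) ((h ^^ b) x)"
        using False funpow_add[of "a - b" b h] by (metis comp_apply le_add_diff_inverse2 nat_le_linear)
      then show ?thesis using pinv(1) funpow_in[of h X x b] h that by simp
    qed
    show "(h' ^^ (a - b)) (u x) = u ((h' ^^ (a - b)) x)"
      if "x \<in> X" for x
    proof -
      have "u (h' y) = h' (u y)" if "y \<in> X" for y
        using inverse_commutes_on[of h' X h u y] h' inv u that by simp
      then show ?thesis using funpow_commute_on[of h' X u x "a - b"] h' that by simp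
    qed
  qed
qed

section \<open>Kin maps\<close>

theorem theorem5p2:
  fixes X :: "'a::metric_space set"
    and f g h \<phi> :: "'a \<Rightarrow> 'a"
    and a b n m :: nat
    and D :: "(nat \<Rightarrow> 'a) \<Rightarrow> (nat \<Rightarrow> 'a) \<Rightarrow> real"
  assumes "continuum X"
    and "\<exists>h'. homeomorphism X X h h'"
    and "continuous_on X \<phi>" and "\<phi> ` X = X"
    and "\<forall>x\<in>X. \<phi> (h x) = h (\<phi> x)"
    and "n \<ge> 1" and "m \<ge> 1"
    and "\<forall>x\<in>X. f x = (h ^^ a) ((\<phi> ^^ n) x)"
    and "\<forall>x\<in>X. g x = (h ^^ b) ((\<phi> ^^ m) x)"
    and "Metric_space (inverse_limit X f) D"
    and "Metric_space.mtopology (inverse_limit X f) D = inverse_limit_topology X f"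
  shows "entropy (inverse_limit X f) D (as_set_valued (diagonal_map g)) =
    entropy X dist
      (set_comp (int_iterate X h (int b - int a)) (int_iterate X \<phi> (int m - int n)))"
proof -
  let ?F = "set_comp (int_iterate X h (int b - int a)) (int_iterate X \<phi> (int m - int n))"
  obtain h' where hom: "homeomorphism X X h h'" using assms(2) by blast
  have h: "h ` X = X" "continuous_on X h" and h': "h' ` X = X"
    and inv: "\<And>x. x \<in> X \<Longrightarrow> h' (h x) = x" "\<And>x. x \<in> X \<Longrightarrow> h (h' x) = x"
    using hom by (auto simp: homeomorphism_def)
  note \<phi> = assms(4)
  have hp: "(h ^^ j) x \<in> X" and pp: "(\<phi> ^^ j) x \<in> X" if "x \<in> X" for j x
    using that h(1) \<phi> by (simp_all add: funpow_in)
  have cont_pow: "continuous_on X (u ^^ j)" if "u ` X = X" "continuous_on X u" for u :: "'a \<Rightarrow> 'a" and j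
  proof (induction j)
    case (Suc j)
    then show ?case using that funpow_image[OF that(1), of j]
      by (simp only: funpow.simps continuous_on_compose)
  qed (simp only: funpow.simps continuous_on_id')
  have h_phi: "h ((\<phi> ^^ j) x) = (\<phi> ^^ j) (h x)" if "x \<in> X" for j x
    using funpow_commute_on[of \<phi> X h x j] \<phi> assms(5) that by simp
  have phi_h: "(\<phi> ^^ i) ((h ^^ j) x) = (h ^^ j) ((\<phi> ^^ i) x)" if "x \<in> X" for i j x
    using funpow_commute_on[of h X "\<phi> ^^ i" x j] h(1) h_phi that by simp
  have phi_phi: "(\<phi> ^^ i) ((\<phi> ^^ j) x) = (\<phi> ^^ (i + j)) x" for i j x
    by (simp add: funpow_add)
  have f: "f ` X = X"
    using assms(8) funpow_image[OF h(1), of a] funpow_image[OF \<phi>, of n]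
    by (metis (no_types, lifting) image_cong image_image)
  have g: "g ` X = X"
    using assms(9) funpow_image[OF h(1), of b] funpow_image[OF \<phi>, of m]
    by (metis (no_types, lifting) image_cong image_image)
  have "continuous_on X (h ^^ a \<circ> \<phi> ^^ n)"
    using cont_pow[OF h(1,2), of a] cont_pow[OF \<phi> assms(3), of n] funpow_image[OF \<phi>, of n]
    by (simp only: continuous_on_compose)
  then have cf: "continuous_on X f"
    using assms(8) by (simp cong: continuous_on_cong)
  interpret metrized_inverse_limit X f D
    using assms(1,10,11) f cf by (intro metrized_inverse_limit.intro) (auto simp: continuum_def)
  have hg: "h (g x) = g (h x)" if "x \<in> X" for x
  proof -
    have "h x \<in> X" using h that by auto
    then show ?thesis
      using assms(9) that h_phi by (simp add: funpow_swap1)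
  qed
  have pg: "(\<phi> ^^ j) (g x) = g ((\<phi> ^^ j) x)" if "x \<in> X" for j x
    using that assms(9) pp by (simp add: phi_h phi_phi add.commute)
  have fg: "f (g x) = g (f x)" if "x \<in> X" for x
  proof -
    have gx: "g x \<in> X" using g that by auto
    have "f (g x) = (h ^^ a) (g ((\<phi> ^^ n) x))" using assms(8) gx pg[OF that] by simp
    also have "\<dots> = g ((h ^^ a) ((\<phi> ^^ n) x))"
      using funpow_commute_on[of h X g "(\<phi> ^^ n) x" a] h(1) hg pp[OF that] by simp
    finally show ?thesis using assms(8) that by simp
  qed
  obtain e where e: "e ` X = X"
    and eF: "\<And>x. x \<in> X \<Longrightarrow> int_iterate X h (int b - int a) x = {e x}"
    and ehab: "\<And>x. x \<in> X \<Longrightarrow> e ((h ^^ a) x) = (h ^^ b) x"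
    and eg: "\<And>x. x \<in> X \<Longrightarrow> e (g x) = g (e x)"
    using int_iterate_homeomorphism[OF h(1) h' inv equalityD1[OF g] hg, of b a] by blast
  have ein: "e x \<in> X" if "x \<in> X" for x using e that by auto
  show ?thesis
  proof (cases "n \<le> m")
    case True
    define k where "k = e \<circ> \<phi> ^^ (m - n)"
    have n: "nat (int m - int n) = m - n" "int m - int n \<ge> 0" using True by auto
    have F: "?F x = {k x}" if "x \<in> X" for x
    proof -
      have "int_iterate X \<phi> (int m - int n) x = {(\<phi> ^^ (m - n)) x}"
        unfolding int_iterate_def n(1) using n(2) by simp
      then show ?thesis using eF pp[OF that] by (simp add: set_comp_def k_def)
    qed
    have kX: "k ` X \<subseteq> X" using ein pp by (auto simp: k_def)
    have gk: "g x = k (f x)" if "x \<in> X" for x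
    proof -
      have "k (f x) = e ((h ^^ a) ((\<phi> ^^ (m - n)) ((\<phi> ^^ n) x)))"
        using assms(8) that pp by (simp add: k_def phi_h)
      also have "\<dots> = (h ^^ b) ((\<phi> ^^ m) x)"
        using True ehab pp that by (simp add: phi_phi)
      finally show ?thesis using assms(9) that by simp
    qed
    have kg: "k (g x) = g (k x)" if "x \<in> X" for x
      using that pg eg pp by (simp add: k_def)
    show ?thesis
    proof (rule entropy_diagonal_map)
      show "g z \<in> ?F (f z)" if "z \<in> X" for z
        using gk[OF that] F[of "f z"] f that by auto
      show "\<exists>x\<in>inverse_limit X f. \<forall>j<N. (g ^^ j) (x j) = xs ! j"
        if "N > 0" "xs \<in> orbits X ?F N" for N xs
        using lift_orbit_of_map[OF f kX gk kg F that] .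
    qed (use g fg in auto)
  next
    case False
    then have n: "nat (- (int m - int n)) = n - m" "\<not> int m - int n \<ge> 0" by auto
    \<comment> \<open>The inverse of \<open>e\<close> on \<open>X\<close>, obtained by exchanging \<open>a\<close> and \<open>b\<close>; it removes \<open>h\<close> from
      the values of \<open>F\<close>, so that \<open>F\<close> becomes the preimage under the single map \<open>p\<close>.\<close>
    obtain e' where e': "e' ` X = X"
      and e'hba: "\<And>x. x \<in> X \<Longrightarrow> e' ((h ^^ b) x) = (h ^^ a) x"
      and e'g: "\<And>x. x \<in> X \<Longrightarrow> e' (g x) = g (e' x)"
      using int_iterate_homeomorphism[OF h(1) h' inv equalityD1[OF g] hg, of a b] by blast
    have e'in: "e' x \<in> X" if "x \<in> X" for x using e' that by auto
    have e'e: "e' (e x) = x" if x: "x \<in> X" for x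
    proof -
      obtain w where "w \<in> X" "x = (h ^^ a) w" using funpow_image[OF h(1), of a] x by (metis imageE)
      then show ?thesis using ehab e'hba by simp
    qed
    have ee': "e (e' x) = x" if x: "x \<in> X" for x
    proof -
      obtain w where "w \<in> X" "x = (h ^^ b) w" using funpow_image[OF h(1), of b] x by (metis imageE)
      then show ?thesis using ehab e'hba by simp
    qed
    define p where "p = \<phi> ^^ (n - m) \<circ> e'"
    have F: "?F x = {y \<in> X. p y = x}" if "x \<in> X" for x
    proof -
      have "int_iterate X \<phi> (int m - int n) x = {w \<in> X. (\<phi> ^^ (n - m)) w = x}"
        unfolding int_iterate_def n(1) using n(2) by simp
      then have "?F x = {e w |w. w \<in> X \<and> (\<phi> ^^ (n - m)) w = x}"
        using eF by (auto simp: set_comp_def)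
      also have "\<dots> = {y \<in> X. p y = x}"
        using ein e'in e'e ee' by (force simp: p_def)
      finally show ?thesis .
    qed
    have fp: "f x = p (g x)" if "x \<in> X" for x
    proof -
      have "p (g x) = (\<phi> ^^ (n - m)) ((h ^^ a) ((\<phi> ^^ m) x))"
        using assms(9) that pp e'hba by (simp add: p_def)
      also have "\<dots> = (h ^^ a) ((\<phi> ^^ n) x)"
        using False pp that by (simp add: phi_h phi_phi)
      finally show ?thesis using assms(8) that by simp
    qed
    have pcomm: "p (g x) = g (p x)" if "x \<in> X" for x
      using e'g that pg e'in by (simp add: p_def)
    show ?thesis
    proof (rule entropy_diagonal_map)
      show "g z \<in> ?F (f z)" if "z \<in> X" for z
      proof -
        have "f z \<in> X" "g z \<in> X" using f g that by auto
        then show ?thesis using fp[OF that] F[of "f z"] by simp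
      qed
      show "\<exists>x\<in>inverse_limit X f. \<forall>j<N. (g ^^ j) (x j) = xs ! j"
        if "N > 0" "xs \<in> orbits X ?F N" for N xs
        using lift_orbit_of_preimages[OF f g fp pcomm F that] .
    qed (use g fg in auto)
  qed
qed

end
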